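(* Let $U\subset\mathbb{Z}^d$ be a finite set of integer vectors, let $c\in\mathbb{Q}^d$, and let $P=c+\mathcal{Z}(U)\subset\mathbb{R}^d$ be the corresponding almost integral zonotope. Then the Ehrhart quasi-polynomial $L_P$ satisfies the GCD-property.
   Context: For a finite set $U=\{u_1,\dots,u_n\}\subset\mathbb{R}^d$, the zonotope $\mathcal{Z}(U)$ is $\{\lambda_1u_1+\dots+\lambda_nu_n \mid 0\le\lambda_i\le 1,\ i=1,\dots,n\}$. A quasi-polynomial is a function $L$ on the positive integers for which there are an integer $\rho>0$ (a period) and polynomials $f_1,\dots,f_\rho\in\mathbb{Q}[x]$ (the constituents) such that $L(t)=f_k(t)$ whenever $t\equiv k \pmod \rho$, for $1\le k\le\rho$; one also writes $f_0:=f_\rho$. The minimal period is the smallest possible period. For a rational polytope $Q\subset\mathbb{R}^d$ (convex hull of finitely many points of $\mathbb{Q}^d$), the function $L_Q(t):=\#(tQ\cap\mathbb{Z}^d)$, $t\in\mathbb{Z}_{>0}$, is a quasi-polynomial, called the Ehrhart quasi-polynomial of $Q$. A quasi-polynomial with period $\rho$ and constituents $f_1,\dots,f_\rho$ has the GCD-property if $f_k=f_\ell$ whenever $\gcd(\rho,k)=\gcd(\rho,\ell)$. By convention $\rho$ is the minimal period (the notion does not depend on which period is used). *)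

theory Defs
  imports
    "HOL-Analysis.Analysis"
    "HOL-Computational_Algebra.Polynomial"
    "HOL-Number_Theory.Cong"
begin

definition zonotope :: "'a::real_vector set \<Rightarrow> 'a set" where
  "zonotope U = {(\<Sum>u\<in>U. a u *\<^sub>R u) |a. \<forall>u\<in>U. 0 \<le> a u \<and> a u \<le> 1}"

definition int_points :: "(real ^ 'd::finite) set" where
  "int_points = {x. \<forall>i. x $ i \<in> \<int>}"

definition rat_points :: "(real ^ 'd::finite) set" where
  "rat_points = {x. \<forall>i. x $ i \<in> \<rat>}"

(* Only the values at t > 0 are ever used. *)
definition ehrhart :: "(real ^ 'd::finite) set \<Rightarrow> nat \<Rightarrow> rat" where
  "ehrhart Q t = of_nat (card ((\<lambda>x. real t *\<^sub>R x) ` Q \<inter> int_points))"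

(* The constituents are indexed by 1, ..., rho, the index rho standing for the residue class 0;
   values of f outside this range are irrelevant. *)
definition has_constituents :: "(nat \<Rightarrow> rat) \<Rightarrow> nat \<Rightarrow> (nat \<Rightarrow> rat poly) \<Rightarrow> bool" where
  "has_constituents L \<rho> f \<longleftrightarrow>
     \<rho> > 0 \<and> (\<forall>k\<in>{1..\<rho>}. \<forall>t>0. [t = k] (mod \<rho>) \<longrightarrow> L t = poly (f k) (of_nat t))"

definition is_period :: "(nat \<Rightarrow> rat) \<Rightarrow> nat \<Rightarrow> bool" where
  "is_period L \<rho> \<longleftrightarrow> (\<exists>f. has_constituents L \<rho> f)"

definition quasi_polynomial :: "(nat \<Rightarrow> rat) \<Rightarrow> bool" where
  "quasi_polynomial L \<longleftrightarrow> (\<exists>\<rho>. is_period L \<rho>)"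

definition minimal_period :: "(nat \<Rightarrow> rat) \<Rightarrow> nat" where
  "minimal_period L = (LEAST \<rho>. is_period L \<rho>)"

(* For a given period the constituents are unique, since each of them is prescribed
   at infinitely many arguments; so the existential quantifier over f makes no choice. *)
definition gcd_property :: "(nat \<Rightarrow> rat) \<Rightarrow> bool" where
  "gcd_property L \<longleftrightarrow>
     quasi_polynomial L \<and>
     (\<exists>f. has_constituents L (minimal_period L) f \<and>
          (\<forall>k\<in>{1..minimal_period L}. \<forall>l\<in>{1..minimal_period L}.
             gcd (minimal_period L) k = gcd (minimal_period L) l \<longrightarrow> f k = f l))"

end

theory Submission imports Defs begin

text \<open>The idea is to count lattice points by removing the generators one at a time, keeping track of
how the count depends on the dilation factor \<open>t\<close>. Let \<open>G\<close> be a discrete subgroup of a Euclidean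
space, \<open>u \<in> G\<close> nonzero, \<open>K\<close> compact and convex, and \<open>p\<close> the orthogonal projection along \<open>u\<close>.
On a line parallel to \<open>u\<close>, the points of \<open>G\<close> form a pattern that is periodic under translation by \<open>u\<close>,
and the line meets \<open>K\<close> in a segment. Sweeping \<open>K\<close> along \<open>[0,t] u\<close> for a natural number \<open>t\<close> lengthens
this segment by \<open>t\<close> full periods, so it gains \<open>t * m\<close> points, where \<open>m\<close> is the number
of points of \<open>G\<close> in one period and is the same for all lines that meet \<open>G\<close>. The lines that
meet both \<open>G\<close> and \<open>K\<close> correspond to the points of \<open>p G \<inter> p K\<close>, whence (\<open>card_sweep\<close>)
the sweep contains \<open>card (G \<inter> K) + t * m * card (p G \<inter> p K)\<close> points of \<open>G\<close>.

The dilate by \<open>t\<close> of a translated zonotope arises from the dilate with one generator \<open>u\<close> fewer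
by such a sweep, and \<open>p G\<close> is again a discrete subgroup. Both terms of the formula
therefore concern a zonotope with fewer generators, in \<open>G\<close> and in \<open>p G\<close> respectively. After all
generators are gone, what is left is the single point \<open>t c\<close>, which is in the group or not. If
\<open>N c \<in> G\<close>, the integers \<open>t\<close> with \<open>t c \<in> G\<close> form a subgroup of the integers that contains
\<open>N\<close>, so this depends on \<open>gcd N t\<close> only; the condition \<open>N c \<in> G\<close> is inherited by the
projections. By induction the count is a polynomial in \<open>t\<close> whose coefficients depend
on \<open>gcd N t\<close> only (\<open>zonotope_count_gcd_polynomial\<close>).

This is the desired property for the period \<open>N\<close>, a common denominator of \<open>c\<close>. To descend to
the minimal period \<open>m\<close> (\<open>gcd_polynomial_imp_gcd_property\<close>), every residue \<open>k\<close> modulo \<open>m\<close> is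
lifted to a residue \<open>k'\<close> modulo \<open>m * N\<close> with \<open>gcd (m * N) k' = gcd m k\<close>. Comparing both descriptions
at the infinitely many arguments congruent to \<open>k'\<close> shows that the constituent of \<open>k\<close> is
determined by \<open>gcd m k\<close>.\<close>

section \<open>Discrete subgroups\<close>

definition discrete_subgroup :: "'a::euclidean_space set \<Rightarrow> bool" where
  "discrete_subgroup G \<longleftrightarrow>
     0 \<in> G \<and> (\<forall>x\<in>G. \<forall>y\<in>G. x - y \<in> G) \<and> (\<forall>B. bounded B \<longrightarrow> finite (G \<inter> B))"

lemma discrete_subgroupD:
  assumes "discrete_subgroup G"
  shows discrete_subgroup_zero: "0 \<in> G"
    and discrete_subgroup_diff: "x \<in> G \<Longrightarrow> y \<in> G \<Longrightarrow> x - y \<in> G"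
    and discrete_subgroup_finite: "bounded B \<Longrightarrow> finite (G \<inter> B)"
  using assms unfolding discrete_subgroup_def by blast+

lemma discrete_subgroup_add:
  assumes "discrete_subgroup G" "x \<in> G" "y \<in> G"
  shows "x + y \<in> G"
  using discrete_subgroup_diff[OF assms(1,2) discrete_subgroup_diff[OF assms(1)
      discrete_subgroup_zero[OF assms(1)] assms(3)]] by simp

lemma discrete_subgroup_scale_nat:
  assumes "discrete_subgroup G" "x \<in> G"
  shows "real n *\<^sub>R x \<in> G"
  by (induction n)
    (auto simp: scaleR_add_left discrete_subgroup_zero discrete_subgroup_add assms)

lemma discrete_subgroup_scale_int:
  assumes G: "discrete_subgroup G" and x: "x \<in> G"
  shows "real_of_int k *\<^sub>R x \<in> G"
proof (cases k rule: int_cases2)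
  case (nonneg n)
  then show ?thesis using discrete_subgroup_scale_nat[OF G x, of n] by simp
next
  case (nonpos n)
  then show ?thesis
    using discrete_subgroup_diff[OF G discrete_subgroup_zero[OF G]
        discrete_subgroup_scale_nat[OF G x, of n]] by simp
qed

lemma discrete_subgroup_int_points: "discrete_subgroup (int_points :: (real ^ 'd::finite) set)"
  unfolding discrete_subgroup_def
proof (intro conjI ballI allI impI)
  fix B :: "(real ^ 'd) set"
  assume "bounded B"
  then obtain r where r: "\<And>x. x \<in> B \<Longrightarrow> norm x \<le> r"
    unfolding bounded_iff by blast
  let ?T = "real_of_int ` {-\<lceil>r\<rceil>..\<lceil>r\<rceil>}"
  have "x \<in> vec_lambda ` (PiE UNIV (\<lambda>_::'d. ?T))" if x: "x \<in> int_points \<inter> B" for x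
  proof -
    have "x $ i \<in> ?T" for i
    proof -
      from x obtain z where z: "x $ i = real_of_int z"
        unfolding int_points_def Ints_def by blast
      have "\<bar>x $ i\<bar> \<le> r"
        using component_le_norm_cart[of x i] r[of x] x by force
      then show ?thesis unfolding z by (intro imageI) (simp, linarith)
    qed
    then show ?thesis
      by (intro image_eqI[of _ _ "vec_nth x"]) auto
  qed
  then have "int_points \<inter> B \<subseteq> vec_lambda ` (PiE UNIV (\<lambda>_::'d. ?T))"
    by (rule subsetI)
  moreover have "finite (vec_lambda ` (PiE UNIV (\<lambda>_::'d. ?T)))"
    by (rule finite_imageI, rule finite_PiE) simp_all
  ultimately show "finite (int_points \<inter> B)"
    by (rule finite_subset)
qed (auto simp: int_points_def)

text \<open>Every real number has exactly one translate by an integer in a given half-open interval of length 1,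
and \<open>S\<close> is stable under these translations.\<close>

lemma card_subgroup_unit_interval:
  fixes S :: "real set"
  assumes S: "discrete_subgroup S" and "1 \<in> S"
  shows "card (S \<inter> {a<..a+1}) = card (S \<inter> {b<..b+1})"
proof -
  have le: "card (S \<inter> {a<..a+1}) \<le> card (S \<inter> {b<..b+1})" for a b :: real
  proof (rule card_inj_on_le)
    let ?f = "\<lambda>s. s + real_of_int \<lfloor>b + 1 - s\<rfloor>"
    show "inj_on ?f (S \<inter> {a<..a+1})"
    proof (rule inj_onI)
      fix x y assume x: "x \<in> S \<inter> {a<..a+1}" and y: "y \<in> S \<inter> {a<..a+1}" and eq: "?f x = ?f y"
      define k where "k = \<lfloor>b + 1 - y\<rfloor> - \<lfloor>b + 1 - x\<rfloor>"
      have "x - y = real_of_int k" using eq by (simp add: k_def)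
      moreover from this have "\<bar>real_of_int k\<bar> < 1" using x y by auto
      then have "k = 0" by linarith
      ultimately show "x = y" by simp
    qed
    show "?f ` (S \<inter> {a<..a+1}) \<subseteq> S \<inter> {b<..b+1}"
    proof
      fix y assume "y \<in> ?f ` (S \<inter> {a<..a+1})"
      then obtain x where x: "x \<in> S" "y = ?f x" by blast
      have "real_of_int \<lfloor>b + 1 - x\<rfloor> \<in> S"
        using discrete_subgroup_scale_int[OF S \<open>1 \<in> S\<close>] by simp
      then have "y \<in> S" using x discrete_subgroup_add[OF S] by blast
      moreover have "b < y" "y \<le> b + 1" using x(2) by linarith+
      ultimately show "y \<in> S \<inter> {b<..b+1}" by simp
    qed
    show "finite (S \<inter> {b<..b+1})"
      by (simp add: discrete_subgroup_finite[OF S])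
  qed
  show ?thesis by (intro antisym le)
qed

lemma card_subgroup_interval:
  fixes S :: "real set"
  assumes S: "discrete_subgroup S" and "1 \<in> S"
  shows "card (S \<inter> {a<..a + real t}) = t * card (S \<inter> {0<..1})"
proof (induction t)
  case (Suc t)
  have "S \<inter> {a<..a + real (Suc t)} =
      (S \<inter> {a<..a + real t}) \<union> (S \<inter> {a + real t<..(a + real t) + 1})"
    by auto
  also have "card \<dots> = card (S \<inter> {a<..a + real t}) + card (S \<inter> {a + real t<..(a + real t) + 1})"
    by (rule card_Un_disjoint) (auto simp: discrete_subgroup_finite[OF S])
  finally show ?case
    using Suc card_subgroup_unit_interval[OF assms, of "a + real t" 0] by simp
qed simp

section \<open>Projection along a vector\<close>

text \<open>Orthogonal projection onto the hyperplane perpendicular to \<open>u\<close>; it is the identity for \<open>u = 0\<close>.\<close>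

definition proj_along :: "'a::euclidean_space \<Rightarrow> 'a \<Rightarrow> 'a" where
  "proj_along u x = x - ((x \<bullet> u) / (u \<bullet> u)) *\<^sub>R u"

lemma linear_proj_along: "linear (proj_along u)"
  by (rule linearI)
    (simp_all add: proj_along_def inner_add_left add_divide_distrib scaleR_add_left
      scaleR_diff_right)

lemma proj_along_self: "proj_along u (s *\<^sub>R u) = 0"
  by (cases "u = 0") (simp_all add: proj_along_def)

lemma proj_along_eq_iff:
  "proj_along u x = proj_along u y \<longleftrightarrow> (\<exists>s. x = y + s *\<^sub>R u)"
proof
  assume "proj_along u x = proj_along u y"
  then have "x = y + ((x \<bullet> u) / (u \<bullet> u) - (y \<bullet> u) / (u \<bullet> u)) *\<^sub>R u"
    by (simp add: proj_along_def algebra_simps)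
  then show "\<exists>s. x = y + s *\<^sub>R u" by blast
next
  assume "\<exists>s. x = y + s *\<^sub>R u"
  then show "proj_along u x = proj_along u y"
    by (auto simp: linear_add[OF linear_proj_along] proj_along_self)
qed

text \<open>A projection of a discrete subgroup can be dense. Along a vector of the subgroup it stays
discrete, because each projected point has a preimage in \<open>G\<close> within distance \<open>norm u\<close>: subtract
the integral part of the component along \<open>u\<close>.\<close>

lemma discrete_subgroup_proj_along:
  assumes G: "discrete_subgroup G" and u: "u \<in> G"
  shows "discrete_subgroup (proj_along u ` G)"
  unfolding discrete_subgroup_def
proof (intro conjI allI impI ballI)
  show "0 \<in> proj_along u ` G"
    using discrete_subgroup_zero[OF G] linear_0[OF linear_proj_along[of u]]
    by (metis imageI)
  show "x - y \<in> proj_along u ` G" if "x \<in> proj_along u ` G" "y \<in> proj_along u ` G" for x y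
    using that discrete_subgroup_diff[OF G]
    by (auto simp flip: linear_diff[OF linear_proj_along])
next
  fix B :: "'a set"
  assume "bounded B"
  then obtain r where r: "\<And>x. x \<in> B \<Longrightarrow> norm x \<le> r"
    unfolding bounded_iff by blast
  have "proj_along u ` G \<inter> B \<subseteq> proj_along u ` (G \<inter> cball 0 (r + norm u))"
  proof
    fix y assume "y \<in> proj_along u ` G \<inter> B"
    then obtain x where x: "x \<in> G" "y = proj_along u x" and "y \<in> B" by blast
    define k where "k = \<lfloor>(x \<bullet> u) / (u \<bullet> u)\<rfloor>"
    let ?x = "x - real_of_int k *\<^sub>R u"
    have "?x \<in> G"
      by (intro discrete_subgroup_diff[OF G] discrete_subgroup_scale_int[OF G] x u)
    moreover have "proj_along u ?x = y"
      unfolding x(2) proj_along_eq_iff by (intro exI[of _ "- real_of_int k"]) simp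
    moreover have "norm ?x \<le> r + norm u"
    proof -
      have "?x = y + frac ((x \<bullet> u) / (u \<bullet> u)) *\<^sub>R u"
        by (simp add: x(2) proj_along_def k_def frac_def algebra_simps)
      also have "norm \<dots> \<le> norm y + \<bar>frac ((x \<bullet> u) / (u \<bullet> u))\<bar> * norm u"
        by (metis norm_scaleR norm_triangle_ineq)
      also have "\<dots> \<le> r + 1 * norm u"
        using r[OF \<open>y \<in> B\<close>] frac_lt_1[of "(x \<bullet> u) / (u \<bullet> u)"]
        by (intro add_mono mult_right_mono) (auto simp: abs_of_nonneg)
      finally show ?thesis by simp
    qed
    ultimately show "y \<in> proj_along u ` (G \<inter> cball 0 (r + norm u))"
      by (metis IntI image_eqI mem_cball_0)
  qed
  then show "finite (proj_along u ` G \<inter> B)"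
    by (rule finite_subset) (simp add: discrete_subgroup_finite[OF G])
qed

text \<open>This subgroup of the reals describes all lines parallel to \<open>u\<close> through a point of \<open>G\<close> at once: the
points of \<open>G\<close> on such a line form a translate of it.\<close>

lemma discrete_subgroup_multiples:
  assumes G: "discrete_subgroup G" and u: "u \<noteq> 0"
  shows "discrete_subgroup {s. s *\<^sub>R u \<in> G}"
  unfolding discrete_subgroup_def
proof (intro conjI allI impI ballI)
  fix B :: "real set"
  assume "bounded B"
  then have "bounded ((\<lambda>s. s *\<^sub>R u) ` B)"
    by (rule bounded_linear_image) (rule bounded_linear_scaleR_left)
  then have "finite (G \<inter> (\<lambda>s. s *\<^sub>R u) ` B)"
    by (rule discrete_subgroup_finite[OF G])
  moreover have "(\<lambda>s. s *\<^sub>R u) ` ({s. s *\<^sub>R u \<in> G} \<inter> B) \<subseteq> G \<inter> (\<lambda>s. s *\<^sub>R u) ` B"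
    by auto
  moreover have "inj_on (\<lambda>s. s *\<^sub>R u) ({s. s *\<^sub>R u \<in> G} \<inter> B)"
    using u by (auto simp: inj_on_def)
  ultimately show "finite ({s. s *\<^sub>R u \<in> G} \<inter> B)"
    by (meson finite_imageD finite_subset)
qed (auto simp: discrete_subgroup_zero[OF G] discrete_subgroup_diff[OF G] scaleR_diff_left)

section \<open>Counting lattice points in a swept body\<close>

definition sweep :: "real \<Rightarrow> 'a::real_vector \<Rightarrow> 'a set \<Rightarrow> 'a set" where
  "sweep t u K = {x + s *\<^sub>R u |x s. x \<in> K \<and> s \<in> {0..t}}"

lemma sweep_eq_sums: "sweep t u K = {x + y |x y. x \<in> K \<and> y \<in> (\<lambda>s. s *\<^sub>R u) ` {0..t}}"
  unfolding sweep_def by blast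

lemma compact_sweep:
  fixes K :: "'a::euclidean_space set"
  assumes "compact K"
  shows "compact (sweep t u K)"
  unfolding sweep_eq_sums
  by (intro compact_sums assms compact_continuous_image continuous_intros) simp

lemma convex_sweep:
  assumes "convex K"
  shows "convex (sweep t u K)"
proof -
  have "linear (\<lambda>s. s *\<^sub>R u)" by (rule linearI) (auto simp: scaleR_add_left)
  then have "convex ((\<lambda>s. s *\<^sub>R u) ` {0..t})" by (rule convex_linear_image) simp
  from convex_sums[OF assms this] show ?thesis
    unfolding sweep_eq_sums by (rule back_subst[of convex]) blast
qed

lemma sweep_zero:
  assumes "0 \<le> t"
  shows "sweep t 0 K = K"
proof -
  have "\<exists>s. s \<in> {0..t}" using assms by (intro exI[of _ 0]) simp
  then show ?thesis unfolding sweep_def scaleR_zero_right add_0_right by blast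
qed

lemma proj_along_sweep:
  assumes "0 \<le> t"
  shows "proj_along u ` sweep t u K = proj_along u ` K"
proof
  show "proj_along u ` sweep t u K \<subseteq> proj_along u ` K"
    by (auto simp: sweep_def linear_add[OF linear_proj_along] proj_along_self)
  have "K \<subseteq> sweep t u K"
    using assms unfolding sweep_def by force
  then show "proj_along u ` K \<subseteq> proj_along u ` sweep t u K" by blast
qed

lemma line_section_interval:
  fixes K :: "'a::euclidean_space set"
  assumes "compact K" "convex K" and u: "u \<noteq> 0" and ne: "x + s0 *\<^sub>R u \<in> K"
  obtains a b where "a \<le> b" "{s. x + s *\<^sub>R u \<in> K} = {a..b}"
proof -
  let ?I = "{s. x + s *\<^sub>R u \<in> K}"
  have "closed ?I"
    using continuous_closed_vimage[of K "\<lambda>s. x + s *\<^sub>R u"] compact_imp_closed[OF assms(1)]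
    by (simp add: vimage_def)
  moreover have "bounded ?I"
  proof -
    obtain r where r: "\<And>y. y \<in> K \<Longrightarrow> norm y \<le> r"
      using compact_imp_bounded[OF assms(1)] unfolding bounded_iff by blast
    have "norm s \<le> (r + norm x) / norm u" if "s \<in> ?I" for s
    proof -
      have "norm (s *\<^sub>R u) \<le> norm (x + s *\<^sub>R u) + norm x"
        by (metis add_diff_cancel_left' norm_triangle_ineq4)
      also have "\<dots> \<le> r + norm x" using r that by simp
      finally show ?thesis using u by (simp add: field_simps)
    qed
    then show ?thesis unfolding bounded_iff by blast
  qed
  moreover have "convex ?I"
  proof (rule convexI)
    fix s t \<mu> \<nu> :: real
    assume st: "s \<in> ?I" "t \<in> ?I" and "0 \<le> \<mu>" "0 \<le> \<nu>" "\<mu> + \<nu> = 1"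
    then have "\<mu> *\<^sub>R (x + s *\<^sub>R u) + \<nu> *\<^sub>R (x + t *\<^sub>R u) \<in> K"
      by (intro convexD[OF assms(2)]) auto
    also have "\<mu> *\<^sub>R (x + s *\<^sub>R u) + \<nu> *\<^sub>R (x + t *\<^sub>R u) =
        (\<mu> + \<nu>) *\<^sub>R x + (\<mu> *\<^sub>R s + \<nu> *\<^sub>R t) *\<^sub>R u"
      by (simp add: algebra_simps)
    finally show "\<mu> *\<^sub>R s + \<nu> *\<^sub>R t \<in> ?I"
      using \<open>\<mu> + \<nu> = 1\<close> by simp
  qed
  ultimately obtain a b where ab: "?I = {a..b}"
    using connected_compact_interval_1[of ?I] convex_connected compact_eq_bounded_closed by blast
  have "s0 \<in> {a..b}" using ne ab by blast
  then have "a \<le> b" by simp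
  then show ?thesis using ab by (rule that)
qed

text \<open>In the coordinate along \<open>u\<close>, the fibre of \<open>K\<close> is an interval \<open>{a..b}\<close> and that of the swept body
is \<open>{a..b + t}\<close>. The difference \<open>{b<..b + t}\<close> consists of \<open>t\<close> periods. The line over
\<open>y\<close> has to meet \<open>K\<close> as well as \<open>G\<close>: the sweep of an empty section is empty.\<close>

lemma card_fibre_sweep:
  fixes K :: "'a::euclidean_space set"
  assumes G: "discrete_subgroup G" and u: "u \<in> G" "u \<noteq> 0"
    and K: "compact K" "convex K"
    and y: "y \<in> proj_along u ` G \<inter> proj_along u ` K"
  shows "card {x \<in> G \<inter> sweep (real t) u K. proj_along u x = y} =
    card {x \<in> G \<inter> K. proj_along u x = y} + t * card ({s. s *\<^sub>R u \<in> G} \<inter> {0<..1})"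
proof -
  obtain x where x: "x \<in> G" "y = proj_along u x" using y by blast
  obtain z where z: "z \<in> K" "proj_along u z = proj_along u x" using y x by auto
  then obtain s0 where "x + s0 *\<^sub>R u \<in> K"
    by (metis proj_along_eq_iff)
  then obtain a b where "a \<le> b" and ab: "{s. x + s *\<^sub>R u \<in> K} = {a..b}"
    using line_section_interval[OF K u(2)] by metis
  define S where "S = {s. s *\<^sub>R u \<in> G}"
  have S: "discrete_subgroup S"
    unfolding S_def by (rule discrete_subgroup_multiples[OF G u(2)])
  have "1 \<in> S" using u by (simp add: S_def)
  have fibre: "card {v \<in> G \<inter> A. proj_along u v = y} = card (S \<inter> {s. x + s *\<^sub>R u \<in> A})"
    for A
  proof -
    have "x + s *\<^sub>R u \<in> G \<longleftrightarrow> s \<in> S" for s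
      using discrete_subgroup_add[OF G x(1), of "s *\<^sub>R u"]
        discrete_subgroup_diff[OF G _ x(1), of "x + s *\<^sub>R u"] by (auto simp: S_def)
    then have "{v \<in> G \<inter> A. proj_along u v = y} = (\<lambda>s. x + s *\<^sub>R u) ` (S \<inter> {s. x + s *\<^sub>R u \<in> A})"
      unfolding x(2) proj_along_eq_iff by blast
    also have "card \<dots> = card (S \<inter> {s. x + s *\<^sub>R u \<in> A})"
      using u by (intro card_image) (auto simp: inj_on_def)
    finally show ?thesis .
  qed
  have swept: "{s. x + s *\<^sub>R u \<in> sweep (real t) u K} = {a..b + real t}"
  proof -
    have "x + s *\<^sub>R u \<in> sweep (real t) u K \<longleftrightarrow> (\<exists>r\<in>{0..real t}. s - r \<in> {a..b})" for s
    proof -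
      have shift: "x + s *\<^sub>R u = z + r *\<^sub>R u \<longleftrightarrow> x + (s - r) *\<^sub>R u = z" for z r
        by (auto simp: algebra_simps)
      have "x + s *\<^sub>R u \<in> sweep (real t) u K \<longleftrightarrow>
          (\<exists>z r. z \<in> K \<and> r \<in> {0..real t} \<and> x + s *\<^sub>R u = z + r *\<^sub>R u)"
        unfolding sweep_def by blast
      then show ?thesis unfolding ab[symmetric] shift by blast
    qed
    moreover have "(\<exists>r\<in>{0..real t}. s - r \<in> {a..b}) \<longleftrightarrow> s \<in> {a..b + real t}" for s
    proof
      assume s: "s \<in> {a..b + real t}"
      \<comment> \<open>The least shift that brings the coordinate below the upper end.\<close>
      show "\<exists>r\<in>{0..real t}. s - r \<in> {a..b}"
        using s \<open>a \<le> b\<close> by (intro bexI[of _ "max 0 (s - b)"]) auto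
    qed auto
    ultimately show ?thesis by blast
  qed
  have "S \<inter> {a..b + real t} = (S \<inter> {a..b}) \<union> (S \<inter> {b<..b + real t})"
    using \<open>a \<le> b\<close> by auto
  also have "card \<dots> = card (S \<inter> {a..b}) + card (S \<inter> {b<..b + real t})"
    by (rule card_Un_disjoint) (auto simp: discrete_subgroup_finite[OF S])
  finally show ?thesis
    unfolding fibre swept ab S_def[symmetric] card_subgroup_interval[OF S \<open>1 \<in> S\<close>] .
qed

lemma card_sweep:
  fixes K :: "'a::euclidean_space set"
  assumes G: "discrete_subgroup G" and u: "u \<in> G" "u \<noteq> 0"
    and K: "compact K" "convex K"
  shows "card (G \<inter> sweep (real t) u K) =
    card (G \<inter> K) + t * card ({s. s *\<^sub>R u \<in> G} \<inter> {0<..1}) *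
      card (proj_along u ` G \<inter> proj_along u ` K)"
proof -
  let ?Y = "proj_along u ` G \<inter> proj_along u ` K"
  have "bounded (proj_along u ` K)"
    by (intro bounded_linear_image compact_imp_bounded[OF K(1)]
        linear_proj_along[unfolded linear_conv_bounded_linear])
  then have finY: "finite ?Y"
    by (rule discrete_subgroup_finite[OF discrete_subgroup_proj_along[OF G u(1)]])
  have fibres: "card (G \<inter> A) = (\<Sum>y\<in>?Y. card {x \<in> G \<inter> A. proj_along u x = y})"
    if "compact A" "proj_along u ` A = proj_along u ` K" for A
  proof -
    have "finite (G \<inter> A)"
      by (rule discrete_subgroup_finite[OF G compact_imp_bounded[OF that(1)]])
    moreover have "proj_along u ` (G \<inter> A) \<subseteq> ?Y" unfolding that(2)[symmetric] by (rule image_Int_subset)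
    ultimately show ?thesis
      using sum.group[of "G \<inter> A" ?Y "proj_along u" "\<lambda>_. 1::nat"] finY
      unfolding card_eq_sum by metis
  qed
  have "card (G \<inter> sweep (real t) u K) =
      (\<Sum>y\<in>?Y. card {x \<in> G \<inter> sweep (real t) u K. proj_along u x = y})"
    by (rule fibres[OF compact_sweep[OF K(1)] proj_along_sweep[OF of_nat_0_le_iff]])
  also have "\<dots> = (\<Sum>y\<in>?Y. card {x \<in> G \<inter> K. proj_along u x = y}
      + t * card ({s. s *\<^sub>R u \<in> G} \<inter> {0<..1}))"
    by (rule sum.cong[OF refl]) (rule card_fibre_sweep[OF G u K])
  also have "\<dots> = card (G \<inter> K) + t * card ({s. s *\<^sub>R u \<in> G} \<inter> {0<..1}) * card ?Y"
    unfolding sum.distrib sum_constant fibres[OF K(1) refl] by (simp only: of_nat_id mult_ac)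
  finally show ?thesis .
qed

section \<open>The count for a dilated zonotope\<close>

text \<open>The \<open>t\<close>-fold dilate of \<open>c\<close> plus the zonotope of a family \<open>w\<close>. An indexed family replaces the set of
generators because a projection may identify generators or send some of them to zero, and a
set would lose their multiplicity.\<close>

definition translated_zonotope :: "'a::real_vector \<Rightarrow> ('i \<Rightarrow> 'a) \<Rightarrow> 'i set \<Rightarrow> real \<Rightarrow> 'a set" where
  "translated_zonotope c w I t =
     {t *\<^sub>R (c + (\<Sum>i\<in>I. a i *\<^sub>R w i)) |a. \<forall>i\<in>I. 0 \<le> a i \<and> a i \<le> 1}"

lemma translated_zonotope_empty: "translated_zonotope c w {} t = {t *\<^sub>R c}"
  by (simp add: translated_zonotope_def)

lemma translated_zonotope_insert:
  assumes "finite I" "i \<notin> I" "0 < t"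
  shows "translated_zonotope c w (insert i I) t = sweep t (w i) (translated_zonotope c w I t)"
proof (intro equalityI subsetI)
  fix x assume "x \<in> translated_zonotope c w (insert i I) t"
  then obtain a where a: "\<forall>j\<in>insert i I. 0 \<le> a j \<and> a j \<le> 1"
    and x: "x = t *\<^sub>R (c + (\<Sum>j\<in>insert i I. a j *\<^sub>R w j))"
    unfolding translated_zonotope_def by blast
  have "x = t *\<^sub>R (c + (\<Sum>j\<in>I. a j *\<^sub>R w j)) + (t * a i) *\<^sub>R w i"
    using assms by (simp add: x algebra_simps)
  moreover have "t * a i \<in> {0..t}" using a assms(3) by (simp add: mult_left_le)
  moreover have "t *\<^sub>R (c + (\<Sum>j\<in>I. a j *\<^sub>R w j)) \<in> translated_zonotope c w I t"
    using a unfolding translated_zonotope_def by blast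
  ultimately show "x \<in> sweep t (w i) (translated_zonotope c w I t)"
    unfolding sweep_def by blast
next
  fix x assume "x \<in> sweep t (w i) (translated_zonotope c w I t)"
  then obtain s a where s: "s \<in> {0..t}" and a: "\<forall>j\<in>I. 0 \<le> a j \<and> a j \<le> 1"
    and x: "x = t *\<^sub>R (c + (\<Sum>j\<in>I. a j *\<^sub>R w j)) + s *\<^sub>R w i"
    unfolding sweep_def translated_zonotope_def by blast
  let ?a = "a(i := s / t)"
  have "(\<Sum>j\<in>I. ?a j *\<^sub>R w j) = (\<Sum>j\<in>I. a j *\<^sub>R w j)"
    using assms(2) by (intro sum.cong) auto
  then have "x = t *\<^sub>R (c + (\<Sum>j\<in>insert i I. ?a j *\<^sub>R w j))"
    using assms by (simp add: x algebra_simps)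
  moreover have "\<forall>j\<in>insert i I. 0 \<le> ?a j \<and> ?a j \<le> 1"
    using a s assms(3) by auto
  ultimately show "x \<in> translated_zonotope c w (insert i I) t"
    unfolding translated_zonotope_def by blast
qed

lemma compact_convex_translated_zonotope:
  fixes w :: "'i \<Rightarrow> 'a::euclidean_space"
  assumes "finite I" "0 < t"
  shows "compact (translated_zonotope c w I t) \<and> convex (translated_zonotope c w I t)"
  using assms(1)
  by induction
    (use assms(2) in \<open>simp_all add: translated_zonotope_empty translated_zonotope_insert
       compact_sweep convex_sweep\<close>)

lemma linear_image_translated_zonotope:
  assumes "linear p"
  shows "p ` translated_zonotope c w I t = translated_zonotope (p c) (p \<circ> w) I t"
proof -
  have "p (t *\<^sub>R (c + (\<Sum>i\<in>I. a i *\<^sub>R w i))) = t *\<^sub>R (p c + (\<Sum>i\<in>I. a i *\<^sub>R (p \<circ> w) i))" for a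
    using assms by (simp add: linear_cmul linear_add linear_sum)
  then show ?thesis
    unfolding translated_zonotope_def setcompr_eq_image image_image by (intro image_cong) simp_all
qed

text \<open>By Bezout, \<open>gcd N t\<close> is an integral combination of \<open>N\<close> and \<open>t\<close>.\<close>

lemma multiple_mem_iff_gcd:
  assumes G: "discrete_subgroup G" and N: "real N *\<^sub>R c \<in> G"
  shows "real t *\<^sub>R c \<in> G \<longleftrightarrow> real (gcd N t) *\<^sub>R c \<in> G"
proof
  assume t: "real t *\<^sub>R c \<in> G"
  obtain a b where "a * int N + b * int t = gcd (int N) (int t)"
    using bezout_int by blast
  then have "real (gcd N t) = of_int a * real N + of_int b * real t"
    by (metis gcd_int_int_eq of_int_add of_int_mult of_int_of_nat_eq)
  then have "real (gcd N t) *\<^sub>R c =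
      of_int a *\<^sub>R (real N *\<^sub>R c) + of_int b *\<^sub>R (real t *\<^sub>R c)"
    by (simp add: scaleR_add_left)
  then show "real (gcd N t) *\<^sub>R c \<in> G"
    using discrete_subgroup_add[OF G discrete_subgroup_scale_int[OF G N]
        discrete_subgroup_scale_int[OF G t]] by metis
next
  assume g: "real (gcd N t) *\<^sub>R c \<in> G"
  obtain k where "t = gcd N t * k" by (meson dvd_def gcd_dvd2)
  then have "real t *\<^sub>R c = real k *\<^sub>R (real (gcd N t) *\<^sub>R c)"
    by (metis mult.commute of_nat_mult scaleR_scaleR)
  then show "real t *\<^sub>R c \<in> G"
    using discrete_subgroup_scale_nat[OF G g] by metis
qed

text \<open>Group, generators and translation vector are arbitrary in the induction on the index set, since
the contribution of the swept directions lives in the projected group \<open>p G\<close>. The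
same \<open>N\<close> serves throughout, so the two polynomial families that are combined are indexed by
the same divisor \<open>gcd N t\<close>.\<close>

lemma zonotope_count_gcd_polynomial:
  fixes w :: "'i \<Rightarrow> 'a::euclidean_space"
  assumes "finite I" "discrete_subgroup G" "w ` I \<subseteq> G" "real N *\<^sub>R c \<in> G"
  shows "\<exists>f :: nat \<Rightarrow> rat poly. \<forall>t>0.
    of_nat (card (G \<inter> translated_zonotope c w I (real t))) = poly (f (gcd N t)) (of_nat t)"
  using assms
proof (induction I arbitrary: G w c rule: finite_induct)
  case empty
  have "of_nat (card (G \<inter> translated_zonotope c w {} (real t))) =
      poly (if real (gcd N t) *\<^sub>R c \<in> G then 1 else 0 :: rat poly) (of_nat t)" for t
    using multiple_mem_iff_gcd[OF empty(1,3), of t]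
    by (cases "real t *\<^sub>R c \<in> G") (auto simp: translated_zonotope_empty)
  then show ?case
    by (intro exI[of _ "\<lambda>g. if real g *\<^sub>R c \<in> G then 1 else 0"]) blast
next
  case (insert i I)
  note G = insert.prems(1)
  let ?u = "w i"
  let ?Z = "\<lambda>t. translated_zonotope c w I (real t)"
  have u: "?u \<in> G" using insert.prems by simp
  obtain f :: "nat \<Rightarrow> rat poly" where
    f: "\<And>t. t > 0 \<Longrightarrow> of_nat (card (G \<inter> ?Z t)) = poly (f (gcd N t)) (of_nat t)"
    using insert.IH[of G w c] insert.prems by auto
  show ?case
  proof (cases "?u = 0")
    case True
    have "translated_zonotope c w (insert i I) (real t) = ?Z t" if "t > 0" for t
      using that insert.hyps True by (simp add: translated_zonotope_insert sweep_zero)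
    then show ?thesis using f by auto
  next
    case False
    let ?p = "proj_along ?u"
    have "real N *\<^sub>R ?p c \<in> ?p ` G"
      using insert.prems(3) by (simp flip: linear_cmul[OF linear_proj_along])
    moreover have "(?p \<circ> w) ` I \<subseteq> ?p ` G" using insert.prems(2) by auto
    ultimately obtain h :: "nat \<Rightarrow> rat poly" where
      h: "\<And>t. t > 0 \<Longrightarrow> of_nat (card (?p ` G \<inter> ?p ` ?Z t)) = poly (h (gcd N t)) (of_nat t)"
      using insert.IH[OF discrete_subgroup_proj_along[OF G u], of "?p \<circ> w" "?p c"]
      unfolding linear_image_translated_zonotope[OF linear_proj_along] by metis
    define m where "m = card ({s. s *\<^sub>R ?u \<in> G} \<inter> {0<..1})"
    have "of_nat (card (G \<inter> translated_zonotope c w (insert i I) (real t))) =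
        poly (f (gcd N t) + monom (of_nat m) 1 * h (gcd N t)) (of_nat t)" if "t > 0" for t
    proof -
      have K: "compact (?Z t)" "convex (?Z t)"
        using that by (simp_all add: compact_convex_translated_zonotope insert.hyps(1))
      have "card (G \<inter> translated_zonotope c w (insert i I) (real t)) =
          card (G \<inter> ?Z t) + t * m * card (?p ` G \<inter> ?p ` ?Z t)"
        using that insert.hyps
        by (simp add: translated_zonotope_insert card_sweep[OF G u False K] m_def)
      then show ?thesis
        using f[OF that] h[OF that] by (simp add: poly_monom mult.commute)
    qed
    then show ?thesis by (intro exI[of _ "\<lambda>g. f g + monom (of_nat m) 1 * h g"]) blast
  qed
qed

section \<open>From a multiple of the period to the minimal period\<close>

text \<open>An elementary choice of \<open>s\<close> suffices, without Dirichlet's theorem: let \<open>s\<close> be the product of the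
primes dividing \<open>M\<close> but not \<open>a\<close>. A prime divisor of \<open>M\<close> then divides exactly one of
\<open>a\<close> and \<open>b * s\<close>, hence not their sum.\<close>

lemma coprime_in_progression:
  fixes a b M :: nat
  assumes "coprime a b" "M > 0"
  shows "\<exists>s. coprime (a + b * s) M"
proof -
  define s where "s = \<Prod>{p \<in> prime_factors M. \<not> p dvd a}"
  have "\<not> p dvd a + b * s" if p: "prime p" "p dvd M" for p
  proof (cases "p dvd a")
    case True
    have "\<not> p dvd b"
      using True assms(1) p(1) by (meson coprime_common_divisor not_prime_unit)
    moreover have "\<not> p dvd s"
    proof
      assume "p dvd s"
      then obtain q where "q \<in> prime_factors M" "\<not> q dvd a" "p dvd q"
        unfolding s_def using prime_dvd_prod_iff[OF _ p(1), of "{p \<in> prime_factors M. \<not> p dvd a}" id]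
        by auto
      then show False
        using True p(1) primes_dvd_imp_eq in_prime_factors_imp_prime by blast
    qed
    ultimately have "\<not> p dvd b * s" using p(1) prime_dvd_mult_iff by blast
    then show ?thesis using True dvd_add_right_iff by blast
  next
    case False
    then have "p \<in> {p \<in> prime_factors M. \<not> p dvd a}"
      using p assms(2) by (auto simp: in_prime_factors_iff)
    then have "p dvd s"
      unfolding s_def by (intro dvd_prodI) auto
    then show ?thesis using False by (simp add: dvd_add_left_iff)
  qed
  then have "coprime (a + b * s) M"
    using prime_factor_nat[of "gcd (a + b * s) M"] by (auto simp: coprime_iff_gcd_eq_1)
  then show ?thesis ..
qed

text \<open>Divide \<open>k\<close> and \<open>m\<close> by their greatest common divisor and make the quotient of \<open>k\<close> coprime to \<open>M\<close>
by moving it along its progression.\<close>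

lemma residue_lift_gcd:
  fixes k m M :: nat
  assumes "m dvd M" "M > 0" "k > 0"
  obtains k' where "k' > 0" "[k' = k] (mod m)" "gcd M k' = gcd m k"
proof -
  define g where "g = gcd m k"
  have "g > 0" using assms by (simp add: g_def)
  obtain k1 m1 where k1: "k = g * k1" and m1: "m = g * m1" and "coprime k1 m1"
    using gcd_coprime_exists[of m k] \<open>g > 0\<close>
    by (metis coprime_commute g_def less_numeral_extra(3) mult.commute)
  obtain s where s: "coprime (k1 + m1 * s) M"
    using coprime_in_progression[OF \<open>coprime k1 m1\<close> assms(2)] by blast
  show ?thesis
  proof (rule that[of "g * (k1 + m1 * s)"])
    show "g * (k1 + m1 * s) > 0" using assms k1 by auto
    show "[g * (k1 + m1 * s) = k] (mod m)"
      by (simp add: k1 m1 cong_def distrib_left mult.assoc[symmetric])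
    obtain M1 where M1: "M = g * M1" using assms(1) unfolding m1 by (metis dvdE dvd_mult_left)
    then have "coprime (k1 + m1 * s) M1" using s by simp
    then have "gcd M1 (k1 + m1 * s) = 1" by (simp add: coprime_iff_gcd_eq_1 gcd.commute)
    then show "gcd M (g * (k1 + m1 * s)) = gcd m k"
      unfolding M1 by (simp add: gcd_mult_distrib_nat[symmetric] g_def)
  qed
qed

text \<open>The minimal period \<open>m\<close> is not known to divide \<open>N\<close> in advance; working modulo \<open>m * N\<close> avoids the question,
since \<open>gcd N (gcd (m * N) t) = gcd N t\<close>.\<close>

lemma gcd_polynomial_imp_gcd_property:
  assumes "N > 0" and L: "\<And>t. t > 0 \<Longrightarrow> L t = poly (f (gcd N t)) (of_nat t)"
  shows "gcd_property L"
proof -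
  have "is_period L N"
    unfolding is_period_def has_constituents_def
  proof (intro exI[of _ "\<lambda>k. f (gcd N k)"] conjI ballI allI impI)
    fix k t :: nat assume "0 < t" "[t = k] (mod N)"
    then show "L t = poly (f (gcd N k)) (of_nat t)"
      using L[of t] cong_gcd_eq[of t k N] by (simp add: gcd.commute)
  qed (rule assms(1))
  define m where "m = minimal_period L"
  have "is_period L m"
    unfolding m_def minimal_period_def by (rule LeastI[of "is_period L", OF \<open>is_period L N\<close>])
  then obtain h where h: "has_constituents L m h" unfolding is_period_def by blast
  then have "m > 0" by (simp add: has_constituents_def)
  have h_eq: "h k = f (gcd N (gcd m k))" if k: "k \<in> {1..m}" for k
  proof -
    obtain k' where k': "k' > 0" "[k' = k] (mod m)" "gcd (m * N) k' = gcd m k"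
      using residue_lift_gcd[of m "m * N" k] \<open>m > 0\<close> assms(1) k by auto
    \<comment> \<open>Two polynomials that agree on this infinite set are equal.\<close>
    let ?T = "(\<lambda>n. of_nat (k' + m * N * n) :: rat) ` UNIV"
    have "poly (h k) x = poly (f (gcd N (gcd m k))) x" if x: "x \<in> ?T" for x
    proof -
      obtain n where n: "x = of_nat (k' + m * N * n)" using x by blast
      let ?t = "k' + m * N * n"
      have "[?t = k] (mod m)"
        using k'(2) by (simp add: cong_def mult.assoc)
      then have "L ?t = poly (h k) x"
        using h k k'(1) n unfolding has_constituents_def by auto
      moreover have "gcd N ?t = gcd N (gcd m k)"
      proof -
        have "gcd (m * N) ?t = gcd m k"
          using k'(3) cong_gcd_eq[of ?t k' "m * N"] by (simp add: gcd.commute cong_def)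
        then show ?thesis
          using gcd.assoc[of N "m * N" ?t] by simp
      qed
      ultimately show ?thesis using L[of ?t] k'(1) n by simp
    qed
    then have "?T \<subseteq> {x. poly (h k - f (gcd N (gcd m k))) x = 0}" by auto
    moreover have "infinite ?T"
      using \<open>m > 0\<close> assms(1)
      by (intro range_inj_infinite injI) (simp del: of_nat_add of_nat_mult)
    ultimately have "h k - f (gcd N (gcd m k)) = 0"
      using poly_roots_finite finite_subset by blast
    then show ?thesis by simp
  qed
  show ?thesis
    unfolding gcd_property_def quasi_polynomial_def m_def[symmetric]
  proof (intro conjI exI[of _ N] exI[of _ h] ballI impI)
    show "h k = h l" if "k \<in> {1..m}" "l \<in> {1..m}" "gcd m k = gcd m l" for k l
      using h_eq[OF that(1)] h_eq[OF that(2)] that(3) by simp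
  qed (rule \<open>is_period L N\<close> h)+
qed

section \<open>The Ehrhart quasi-polynomial\<close>

lemma rat_points_common_denominator:
  assumes "c \<in> rat_points"
  obtains N :: nat where "N > 0" "real N *\<^sub>R c \<in> int_points"
proof -
  have "\<exists>n::nat. n > 0 \<and> real n * c $ i \<in> \<int>" for i
  proof -
    have "c $ i \<in> \<rat>" using assms by (simp add: rat_points_def)
    then obtain a b where "b > 0" "c $ i = of_int a / of_int b" by (auto elim: Rats_cases')
    then show ?thesis by (intro exI[of _ "nat b"]) auto
  qed
  then obtain n :: "'a \<Rightarrow> nat" where n: "\<And>i. n i > 0" "\<And>i. real (n i) * c $ i \<in> \<int>" by metis
  show ?thesis
  proof (rule that[of "prod n UNIV"])
    show "prod n UNIV > 0" using n(1) by simp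
    have "real (prod n UNIV) * c $ i \<in> \<int>" for i
    proof -
      have "real (prod n UNIV) * c $ i = real (prod n (UNIV - {i})) * (real (n i) * c $ i)"
        by (subst prod.remove[of UNIV i]) auto
      then show ?thesis using n(2) by (metis Ints_mult Ints_of_nat)
    qed
    then show "real (prod n UNIV) *\<^sub>R c \<in> int_points" by (simp add: int_points_def)
  qed
qed

theorem theorem2p3:
  fixes U :: "(real ^ 'd::finite) set" and c :: "real ^ 'd" and P :: "(real ^ 'd) set"
  assumes "finite U" and "U \<subseteq> int_points" and "c \<in> rat_points"
    and "P = (\<lambda>x. c + x) ` zonotope U"
  shows "gcd_property (ehrhart P)"
proof -
  obtain N where N: "N > 0" "real N *\<^sub>R c \<in> int_points"
    using rat_points_common_denominator[OF assms(3)] by blast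
  have dilate: "(\<lambda>x. real t *\<^sub>R x) ` P = translated_zonotope c (\<lambda>u. u) U (real t)" for t
    unfolding assms(4) zonotope_def translated_zonotope_def setcompr_eq_image image_image ..
  obtain f :: "nat \<Rightarrow> rat poly" where f: "\<And>t. t > 0 \<Longrightarrow>
      of_nat (card (int_points \<inter> translated_zonotope c (\<lambda>u. u) U (real t))) =
        poly (f (gcd N t)) (of_nat t)"
    using zonotope_count_gcd_polynomial[OF assms(1) discrete_subgroup_int_points, of "\<lambda>u. u" N c]
      assms(2) N(2) by auto
  show ?thesis
    by (rule gcd_polynomial_imp_gcd_property[OF N(1), of _ f])
      (simp only: ehrhart_def dilate Int_commute f)
qed

end
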